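(* Let $\mathbf{S}$ be a completely simple semigroup, and let $\rho,\sigma,\eta$ be congruences on $\mathbf{S}$ such that $\eta\le\rho$ and $\eta\le\sigma$. Then in the quotient semigroup $\mathbf{S}/\eta$ we have $[\rho/\eta,\sigma/\eta]=([\rho,\sigma]\vee\eta)/\eta$.
   Context: A completely simple semigroup is a simple semigroup (no proper ideals) containing a primitive idempotent, i.e. an element $e$ such that $x=e$ is the unique solution of $ex=xe=x=x^2$. $\mathbb{N}=\{1,2,\dots\}$. For an algebra $\mathbf{A}$ and congruences $\alpha,\beta,\delta$ of $\mathbf{A}$, $C(\alpha,\beta;\delta)$ means: for all $n\in\mathbb{N}$, all $(n+1)$-ary term functions $t$ of $\mathbf{A}$, all $a,b\in A$ and $\mathbf{c},\mathbf{d}\in A^n$ with $a\,\alpha\,b$ and $c_i\,\beta\,d_i$ for every $i$, $t(a,\mathbf{c})\,\delta\,t(a,\mathbf{d})$ implies $t(b,\mathbf{c})\,\delta\,t(b,\mathbf{d})$. The commutator $[\alpha,\beta]$ is the least congruence $\delta$ with $C(\alpha,\beta;\delta)$. Semigroups are algebras with one binary operation. Congruences are ordered by inclusion and $\vee$ is the join in the congruence lattice. For a congruence $\theta\ge\eta$, $\theta/\eta$ is the congruence on $\mathbf{S}/\eta$ with $(x/\eta)\,(\theta/\eta)\,(y/\eta)\iff x\,\theta\,y$. *)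

theory Defs
  imports Main
begin

text \<open>Semigroups are given by a carrier set and a multiplication that is only relevant on the
  carrier, so that a quotient is again a semigroup of the same kind.\<close>

locale semigroup_on =
  fixes S :: "'a set" and mul :: "'a \<Rightarrow> 'a \<Rightarrow> 'a"
  assumes closed: "x \<in> S \<Longrightarrow> y \<in> S \<Longrightarrow> mul x y \<in> S"
    and assoc: "x \<in> S \<Longrightarrow> y \<in> S \<Longrightarrow> z \<in> S \<Longrightarrow> mul (mul x y) z = mul x (mul y z)"

definition semigroup_ideal :: "'a set \<Rightarrow> ('a \<Rightarrow> 'a \<Rightarrow> 'a) \<Rightarrow> 'a set \<Rightarrow> bool" where
  "semigroup_ideal S mul I \<longleftrightarrow>
     I \<subseteq> S \<and> I \<noteq> {} \<and> (\<forall>s\<in>S. \<forall>x\<in>I. mul s x \<in> I \<and> mul x s \<in> I)"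

text \<open>Taking \<open>x = e\<close> in the equivalence shows that \<open>e\<close> is idempotent.\<close>

definition primitive_idempotent :: "'a set \<Rightarrow> ('a \<Rightarrow> 'a \<Rightarrow> 'a) \<Rightarrow> 'a \<Rightarrow> bool" where
  "primitive_idempotent S mul e \<longleftrightarrow>
     e \<in> S \<and> (\<forall>x\<in>S. (mul e x = x \<and> mul x e = x \<and> mul x x = x) \<longleftrightarrow> x = e)"

locale completely_simple_semigroup = semigroup_on +
  assumes simple: "semigroup_ideal S mul I \<Longrightarrow> I = S"
    and ex_primitive: "\<exists>e. primitive_idempotent S mul e"

definition congruence_on :: "'a set \<Rightarrow> ('a \<Rightarrow> 'a \<Rightarrow> 'a) \<Rightarrow> ('a \<times> 'a) set \<Rightarrow> bool" where
  "congruence_on S mul r \<longleftrightarrow>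
     equiv S r \<and> (\<forall>(a, b)\<in>r. \<forall>(c, d)\<in>r. (mul a c, mul b d) \<in> r)"

datatype binary_term = Var nat | Mul binary_term binary_term

primrec vars :: "binary_term \<Rightarrow> nat set" where
  "vars (Var i) = {i}"
| "vars (Mul s t) = vars s \<union> vars t"

primrec eval_term :: "('a \<Rightarrow> 'a \<Rightarrow> 'a) \<Rightarrow> binary_term \<Rightarrow> 'a list \<Rightarrow> 'a" where
  "eval_term mul (Var i) xs = xs ! i"
| "eval_term mul (Mul s t) xs = mul (eval_term mul s xs) (eval_term mul t xs)"

definition term_functions :: "('a \<Rightarrow> 'a \<Rightarrow> 'a) \<Rightarrow> nat \<Rightarrow> ('a list \<Rightarrow> 'a) set" where
  "term_functions mul k = {eval_term mul t | t. vars t \<subseteq> {..<k}}"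

text \<open>\<open>centralizes S mul \<alpha> \<beta> \<delta>\<close> is the condition \<open>C(\<alpha>,\<beta>;\<delta>)\<close>.\<close>

definition centralizes ::
  "'a set \<Rightarrow> ('a \<Rightarrow> 'a \<Rightarrow> 'a) \<Rightarrow> ('a \<times> 'a) set \<Rightarrow> ('a \<times> 'a) set \<Rightarrow> ('a \<times> 'a) set \<Rightarrow> bool" where
  "centralizes S mul \<alpha> \<beta> \<delta> \<longleftrightarrow>
     (\<forall>n\<ge>1. \<forall>t\<in>term_functions mul (n + 1). \<forall>a\<in>S. \<forall>b\<in>S. \<forall>c\<in>lists S. \<forall>d\<in>lists S.
        length c = n \<longrightarrow> length d = n \<longrightarrow> (a, b) \<in> \<alpha> \<longrightarrow> (\<forall>i<n. (c ! i, d ! i) \<in> \<beta>) \<longrightarrow>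
        (t (a # c), t (a # d)) \<in> \<delta> \<longrightarrow> (t (b # c), t (b # d)) \<in> \<delta>)"

definition commutator ::
  "'a set \<Rightarrow> ('a \<Rightarrow> 'a \<Rightarrow> 'a) \<Rightarrow> ('a \<times> 'a) set \<Rightarrow> ('a \<times> 'a) set \<Rightarrow> ('a \<times> 'a) set" where
  "commutator S mul \<alpha> \<beta> = (LEAST \<delta>. congruence_on S mul \<delta> \<and> centralizes S mul \<alpha> \<beta> \<delta>)"

definition congruence_join ::
  "'a set \<Rightarrow> ('a \<Rightarrow> 'a \<Rightarrow> 'a) \<Rightarrow> ('a \<times> 'a) set \<Rightarrow> ('a \<times> 'a) set \<Rightarrow> ('a \<times> 'a) set" where
  "congruence_join S mul \<alpha> \<beta> = (LEAST \<theta>. congruence_on S mul \<theta> \<and> \<alpha> \<subseteq> \<theta> \<and> \<beta> \<subseteq> \<theta>)"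

text \<open>The quotient by a congruence \<open>\<eta>\<close> has carrier \<open>S // \<eta>\<close>. For classes \<open>X\<close> and \<open>Y\<close> all the
  classes in the union below coincide.\<close>

definition quotient_mul ::
  "('a \<Rightarrow> 'a \<Rightarrow> 'a) \<Rightarrow> ('a \<times> 'a) set \<Rightarrow> 'a set \<Rightarrow> 'a set \<Rightarrow> 'a set" where
  "quotient_mul mul \<eta> X Y = (\<Union>x\<in>X. \<Union>y\<in>Y. \<eta> `` {mul x y})"

definition quotient_congruence ::
  "('a \<times> 'a) set \<Rightarrow> ('a \<times> 'a) set \<Rightarrow> ('a set \<times> 'a set) set" where
  "quotient_congruence \<theta> \<eta> = {(\<eta> `` {x}, \<eta> `` {y}) | x y. (x, y) \<in> \<theta>}"

text \<open>The least congruences above exist, because the congruences in question are closed under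
  intersection and the total relation is one of them.\<close>

lemma Least_Inter_closed:
  fixes P :: "'b set \<Rightarrow> bool"
  assumes "P (\<Inter>{d. P d})"
  shows "(LEAST d. P d) = \<Inter>{d. P d}"
  using assms by (intro Least_equality) auto

lemma congruence_on_Inter:
  assumes "D \<noteq> {}" "\<And>d. d \<in> D \<Longrightarrow> congruence_on S mul d"
  shows "congruence_on S mul (\<Inter>D)"
proof -
  have eq: "equiv S d" if "d \<in> D" for d
    using assms(2)[OF that] by (simp add: congruence_on_def)
  have comp: "(mul x u, mul y v) \<in> d" if "d \<in> D" "(x, y) \<in> d" "(u, v) \<in> d" for d x y u v
    using assms(2)[OF that(1)] that(2,3) unfolding congruence_on_def by blast
  have "equiv S (\<Inter>D)"
  proof (rule equivI)
    obtain d where "d \<in> D" using assms(1) by blast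
    then show "\<Inter>D \<subseteq> S \<times> S" using eq[of d] by (auto simp: equiv_def)
    show "refl_on S (\<Inter>D)"
      by (rule refl_onI, rule InterI) (metis eq equivE refl_onD)
    show "sym (\<Inter>D)"
      by (rule symI, rule InterI) (metis InterD eq equivE symD)
    show "trans (\<Inter>D)"
      by (rule transI, rule InterI) (metis InterD eq equivE transD)
  qed
  moreover have "(mul x u, mul y v) \<in> \<Inter>D" if "(x, y) \<in> \<Inter>D" "(u, v) \<in> \<Inter>D" for x y u v
    using that by (intro InterI comp) (auto dest: InterD)
  ultimately show ?thesis unfolding congruence_on_def by auto
qed

context semigroup_on
begin

lemma congruence_on_total: "congruence_on S mul (S \<times> S)"
  by (auto simp: congruence_on_def equiv_def refl_on_def sym_def trans_def closed)

lemma eval_term_closed: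
  assumes "set xs \<subseteq> S" "vars t \<subseteq> {..<length xs}"
  shows "eval_term mul t xs \<in> S"
  using assms by (induction t) (auto intro: closed)

lemma centralizes_total: "centralizes S mul \<alpha> \<beta> (S \<times> S)"
  by (auto simp: centralizes_def term_functions_def intro!: eval_term_closed)

lemma commutator_least:
  shows "congruence_on S mul (commutator S mul \<alpha> \<beta>)"
    and "centralizes S mul \<alpha> \<beta> (commutator S mul \<alpha> \<beta>)"
    and "congruence_on S mul \<delta> \<Longrightarrow> centralizes S mul \<alpha> \<beta> \<delta> \<Longrightarrow> commutator S mul \<alpha> \<beta> \<subseteq> \<delta>"
proof -
  let ?P = "\<lambda>\<delta>. congruence_on S mul \<delta> \<and> centralizes S mul \<alpha> \<beta> \<delta>"
  have cong: "congruence_on S mul (\<Inter>{d. ?P d})"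
    using congruence_on_total centralizes_total by (intro congruence_on_Inter) auto
  have cent: "centralizes S mul \<alpha> \<beta> (\<Inter>{d. ?P d})"
    unfolding centralizes_def[of S mul \<alpha> \<beta> "\<Inter>{d. ?P d}"]
  proof (intro allI ballI impI InterI)
    fix n t a b c d x
    assume *: "1 \<le> n" "t \<in> term_functions mul (n + 1)" "a \<in> S" "b \<in> S" "c \<in> lists S"
      "d \<in> lists S" "length c = n" "length d = n" "(a, b) \<in> \<alpha>" "\<forall>i<n. (c ! i, d ! i) \<in> \<beta>"
      "(t (a # c), t (a # d)) \<in> \<Inter>{d. ?P d}" "x \<in> {d. ?P d}"
    from *(11,12) have 1: "(t (a # c), t (a # d)) \<in> x" by (rule InterD)
    from *(12) have "centralizes S mul \<alpha> \<beta> x" by simp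
    from this[unfolded centralizes_def, rule_format, OF *(1-9) *(10)[rule_format] 1]
    show "(t (b # c), t (b # d)) \<in> x" .
  qed
  have eq: "commutator S mul \<alpha> \<beta> = \<Inter>{d. ?P d}"
    unfolding commutator_def by (rule Least_Inter_closed[where P = ?P]) (rule conjI[OF cong cent])
  show "congruence_on S mul (commutator S mul \<alpha> \<beta>)"
    and "centralizes S mul \<alpha> \<beta> (commutator S mul \<alpha> \<beta>)"
    and "congruence_on S mul \<delta> \<Longrightarrow> centralizes S mul \<alpha> \<beta> \<delta> \<Longrightarrow> commutator S mul \<alpha> \<beta> \<subseteq> \<delta>"
    unfolding eq by (rule cong, rule cent, rule Inter_lower, simp)
qed

lemma congruence_join_least:
  assumes "congruence_on S mul \<alpha>" "congruence_on S mul \<beta>"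
  shows "congruence_on S mul (congruence_join S mul \<alpha> \<beta>)"
    and "\<alpha> \<subseteq> congruence_join S mul \<alpha> \<beta>" and "\<beta> \<subseteq> congruence_join S mul \<alpha> \<beta>"
    and "congruence_on S mul \<theta> \<Longrightarrow> \<alpha> \<subseteq> \<theta> \<Longrightarrow> \<beta> \<subseteq> \<theta> \<Longrightarrow> congruence_join S mul \<alpha> \<beta> \<subseteq> \<theta>"
proof -
  let ?P = "\<lambda>\<theta>. congruence_on S mul \<theta> \<and> \<alpha> \<subseteq> \<theta> \<and> \<beta> \<subseteq> \<theta>"
  have "\<alpha> \<subseteq> S \<times> S" "\<beta> \<subseteq> S \<times> S"
    using assms by (auto simp: congruence_on_def equiv_def)
  then have cong: "congruence_on S mul (\<Inter>{d. ?P d})"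
    using congruence_on_total by (intro congruence_on_Inter) auto
  then have eq: "congruence_join S mul \<alpha> \<beta> = \<Inter>{d. ?P d}"
    unfolding congruence_join_def by (intro Least_Inter_closed) auto
  show "congruence_on S mul (congruence_join S mul \<alpha> \<beta>)"
    and "\<alpha> \<subseteq> congruence_join S mul \<alpha> \<beta>" and "\<beta> \<subseteq> congruence_join S mul \<alpha> \<beta>"
    and "congruence_on S mul \<theta> \<Longrightarrow> \<alpha> \<subseteq> \<theta> \<Longrightarrow> \<beta> \<subseteq> \<theta> \<Longrightarrow> congruence_join S mul \<alpha> \<beta> \<subseteq> \<theta>"
    using cong by (auto simp: eq)
qed

lemma quotient_mul_class:
  assumes "congruence_on S mul \<eta>" "x \<in> S" "y \<in> S"
  shows "quotient_mul mul \<eta> (\<eta> `` {x}) (\<eta> `` {y}) = \<eta> `` {mul x y}"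
proof -
  have "equiv S \<eta>" using assms by (simp add: congruence_on_def)
  moreover have "congruent2 \<eta> \<eta> (\<lambda>x y. \<eta> `` {mul x y})"
    using assms(1) by (fastforce simp: congruence_on_def intro!: congruent2I' equiv_class_eq)
  ultimately show ?thesis
    unfolding quotient_mul_def using assms(2,3) by (intro UN_equiv_class2)
qed

lemma semigroup_on_quotient:
  assumes "congruence_on S mul \<eta>"
  shows "semigroup_on (S // \<eta>) (quotient_mul mul \<eta>)"
proof
  fix X Y Z
  assume "X \<in> S // \<eta>" "Y \<in> S // \<eta>"
  then obtain x y where xy: "x \<in> S" "X = \<eta> `` {x}" "y \<in> S" "Y = \<eta> `` {y}"
    by (elim quotientE)
  then show "quotient_mul mul \<eta> X Y \<in> S // \<eta>"
    by (simp add: quotient_mul_class[OF assms] closed quotientI)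
  assume "Z \<in> S // \<eta>"
  then obtain z where "z \<in> S" "Z = \<eta> `` {z}" by (elim quotientE)
  with xy show "quotient_mul mul \<eta> (quotient_mul mul \<eta> X Y) Z
      = quotient_mul mul \<eta> X (quotient_mul mul \<eta> Y Z)"
    by (simp add: quotient_mul_class[OF assms] closed assoc)
qed

lemma quotient_congruence_iff:
  assumes "congruence_on S mul \<eta>" "congruence_on S mul \<theta>" "\<eta> \<subseteq> \<theta>" "x \<in> S" "y \<in> S"
  shows "(\<eta> `` {x}, \<eta> `` {y}) \<in> quotient_congruence \<theta> \<eta> \<longleftrightarrow> (x, y) \<in> \<theta>"
proof
  assume "(\<eta> `` {x}, \<eta> `` {y}) \<in> quotient_congruence \<theta> \<eta>"
  then obtain u v where uv: "\<eta> `` {x} = \<eta> `` {u}" "\<eta> `` {y} = \<eta> `` {v}" "(u, v) \<in> \<theta>"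
    by (auto simp: quotient_congruence_def)
  have eq: "equiv S \<eta>" "equiv S \<theta>" using assms by (auto simp: congruence_on_def)
  then have "u \<in> S" "v \<in> S" using uv(3) by (auto simp: equiv_def)
  then have "(x, u) \<in> \<theta>" "(v, y) \<in> \<theta>"
    using uv(1,2) eq(1) assms(3-5) by (metis eq_equiv_class subsetD)+
  then show "(x, y) \<in> \<theta>" using uv(3) eq(2) by (meson equivE transD)
qed (auto simp: quotient_congruence_def)

end

end

theory Submission
  imports Defs
begin

text \<open>Congruences of \<open>S/\<eta>\<close> correspond to congruences of \<open>S\<close> above \<open>\<eta>\<close>. Since terms commute with
  the quotient map, this correspondence turns \<open>C(\<rho>/\<eta>,\<sigma>/\<eta>;\<theta>/\<eta>)\<close> into \<open>C(\<rho>,\<sigma>;\<theta>)\<close>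
  (\<open>centralizes_quotient_iff\<close>). So \<open>[\<rho>/\<eta>,\<sigma>/\<eta>]\<close> is \<open>\<theta>/\<eta>\<close> for the least \<open>\<theta> \<supseteq> \<eta>\<close> with
  \<open>C(\<rho>,\<sigma>;\<theta>)\<close>. Such a \<open>\<theta>\<close> contains \<open>[\<rho>,\<sigma>]\<close>, hence \<open>[\<rho>,\<sigma>] \<or> \<eta>\<close>, and what has to be shown is
  that the join itself qualifies. This is the content of \<open>centralizes_mono\<close>: in a completely
  simple semigroup \<open>C(\<rho>,\<sigma>;\<delta>)\<close> passes from a congruence to every larger one, which fails in
  general algebras.

  Let \<open>C(\<rho>,\<sigma>;\<delta>\<^sub>0)\<close> and \<open>\<delta>\<^sub>0 \<subseteq> \<delta>\<close>, and put \<open>A = t(a,c)\<close>, \<open>A' = t(a,d)\<close>, \<open>B = t(b,c)\<close>,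
  \<open>B' = t(b,d)\<close> with \<open>A \<delta> A'\<close>. In a group one would use the Mal'cev operation \<open>x y\<inverse> z\<close>. Here a
  primitive idempotent \<open>e\<close> makes \<open>eSe\<close> a group, and the inverse \<open>u\<close> of \<open>eAe\<close> is an element of \<open>S\<close>,
  so it may be used as a constant. The polynomial \<open>F(x,z,z') = e t(x,z) e u e t(a,z') e\<close> takes the
  same value \<open>eA'e\<close> at \<open>(a,c,d)\<close> and at \<open>(a,d,c)\<close>. By \<open>C(\<rho>,\<sigma>;\<delta>\<^sub>0)\<close> its values at \<open>(b,c,d)\<close> and
  \<open>(b,d,c)\<close> are congruent modulo \<open>\<delta>\<^sub>0\<close>. The latter is \<open>eB'e\<close>, the former is \<open>\<delta>\<close>-related to
  \<open>eBe u eAe = eBe\<close>. Thus \<open>eBe \<delta> eB'e\<close> (\<open>centralizes_local\<close>).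

  To remove the outer factors \<open>e\<close>, one needs \<open>f\<close> with \<open>fe = f\<close> that fixes \<open>B\<close> and \<open>B'\<close> from the left
  modulo \<open>\<delta>\<close>, and dually \<open>g\<close> on the right, because then \<open>B \<delta> fBg = f(eBe)g\<close>, and likewise for \<open>B'\<close>
  (\<open>rel_if_local_rel\<close>). Whether \<open>f\<close> fixes a product depends only on the first factor, and every
  element has such a left unit (\<open>left_unit_below\<close>). If the first variable of \<open>t\<close> is \<open>x\<close>, then \<open>B\<close>
  and \<open>B'\<close> have the same first factor. Otherwise \<open>B\<close> shares it with \<open>A\<close>, and \<open>B'\<close> with \<open>A'\<close>, so that \<open>A \<delta> A'\<close>
  transports the left unit (\<open>common_left_unit\<close>).\<close>

section \<open>Completely simple semigroups around a primitive idempotent\<close>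

context completely_simple_semigroup
begin

notation mul (infixl "\<cdot>" 70)

lemma primitive_idempotentD:
  assumes "primitive_idempotent S (\<cdot>) e"
  shows "e \<in> S" and "e \<cdot> e = e"
    and "x \<in> S \<Longrightarrow> e \<cdot> x = x \<Longrightarrow> x \<cdot> e = x \<Longrightarrow> x \<cdot> x = x \<Longrightarrow> x = e"
  using assms unfolding primitive_idempotent_def by blast+

text \<open>Since \<open>SxS\<close> is an ideal, simplicity gives \<open>SxS = S\<close>.\<close>

lemma factor_through:
  assumes "x \<in> S" "y \<in> S"
  obtains p q where "p \<in> S" "q \<in> S" "y = p \<cdot> x \<cdot> q"
proof -
  let ?I = "{p \<cdot> x \<cdot> q | p q. p \<in> S \<and> q \<in> S}"
  have "s \<cdot> (p \<cdot> x \<cdot> q) = (s \<cdot> p) \<cdot> x \<cdot> q \<and> p \<cdot> x \<cdot> q \<cdot> s = p \<cdot> x \<cdot> (q \<cdot> s)"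
    if "s \<in> S" "p \<in> S" "q \<in> S" for s p q
    using that assms(1) by (simp add: assoc closed)
  then have "semigroup_ideal S (\<cdot>) ?I"
    unfolding semigroup_ideal_def using assms(1) closed by (auto; blast)
  then show thesis using simple[of ?I] assms(2) that by blast
qed

text \<open>The monoid \<open>eSe\<close> is a group. By simplicity \<open>p y q = e\<close> for some \<open>p, q\<close> in \<open>eSe\<close>, where
  \<open>y = exe\<close>. Then \<open>y q p\<close> and \<open>q p y\<close> are idempotents below \<open>e\<close>, so primitivity makes both equal to \<open>e\<close>,
  and \<open>q p\<close> is the inverse of \<open>y\<close>.\<close>

lemma inverse_in_local_monoid:
  assumes e: "primitive_idempotent S (\<cdot>) e" and x: "x \<in> S"
  obtains u where "u \<in> S" "e \<cdot> u = u" "u \<cdot> e = u"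
    "e \<cdot> x \<cdot> e \<cdot> u = e" "u \<cdot> (e \<cdot> x \<cdot> e) = e"
proof -
  note [simp] = primitive_idempotentD(1,2)[OF e] x closed assoc
  have ee: "e \<cdot> (e \<cdot> y) = e \<cdot> y" if "y \<in> S" for y
    using that by (simp flip: assoc)
  let ?x = "e \<cdot> x \<cdot> e"
  obtain p q where pq [simp]: "p \<in> S" "q \<in> S" and "e = p \<cdot> ?x \<cdot> q"
    by (rule factor_through[of ?x e]) auto
  then have "e = e \<cdot> (p \<cdot> ?x \<cdot> q) \<cdot> e" by simp
  then have "(e \<cdot> p \<cdot> e) \<cdot> ?x \<cdot> (e \<cdot> q \<cdot> e) = e" by (simp add: ee)
  moreover define p' q' where "p' = e \<cdot> p \<cdot> e" and "q' = e \<cdot> q \<cdot> e"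
  moreover define y where "y = ?x"
  ultimately have pxq: "p' \<cdot> y \<cdot> q' = e" by simp
  have in_S [simp]: "p' \<in> S" "q' \<in> S" "y \<in> S"
    and e_left [simp]: "e \<cdot> p' = p'" "e \<cdot> q' = q'" "e \<cdot> y = y"
    and e_right [simp]: "p' \<cdot> e = p'" "q' \<cdot> e = q'" "y \<cdot> e = y"
    by (simp_all add: p'_def q'_def y_def ee)
  have e_left' [simp]: "e \<cdot> (p' \<cdot> z) = p' \<cdot> z" "e \<cdot> (q' \<cdot> z) = q' \<cdot> z" "e \<cdot> (y \<cdot> z) = y \<cdot> z"
    if "z \<in> S" for z
    using that e_left in_S by (metis assoc primitive_idempotentD(1)[OF e])+
  have pxq': "p' \<cdot> (y \<cdot> (q' \<cdot> z)) = e \<cdot> z" if "z \<in> S" for z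
    using that pxq by (metis assoc closed in_S)
  have "y \<cdot> (q' \<cdot> p') = e" "q' \<cdot> (p' \<cdot> y) = e"
    by (rule primitive_idempotentD(3)[OF e]; simp add: pxq')+
  then show thesis
    by (intro that[of "q' \<cdot> p'"]) (simp_all flip: y_def)
qed

text \<open>In terms of Green's relations, \<open>f\<close> is the idempotent that is \<open>\<R>\<close>-related to \<open>x\<close> and
  \<open>\<L>\<close>-related to \<open>e\<close>. With \<open>x = p e q\<close> and \<open>v\<close> the inverse of \<open>e p e\<close> in \<open>eSe\<close>, it is \<open>p v\<close>.\<close>

lemma left_unit_below:
  assumes e: "primitive_idempotent S (\<cdot>) e" and x: "x \<in> S"
  obtains f where "f \<in> S" "f \<cdot> e = f" "f \<cdot> x = x"
proof -
  note [simp] = primitive_idempotentD(1,2)[OF e] x closed assoc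
  obtain p q where [simp]: "p \<in> S" "q \<in> S" and x_eq: "x = p \<cdot> e \<cdot> q"
    by (rule factor_through[of e x]) auto
  obtain v where v: "v \<in> S" "v \<cdot> e = v" "v \<cdot> (e \<cdot> p \<cdot> e) = e"
    by (rule inverse_in_local_monoid[OF e \<open>p \<in> S\<close>])
  have "v \<cdot> (p \<cdot> e) = (v \<cdot> e) \<cdot> (p \<cdot> e)" by (simp only: v)
  also have "\<dots> = v \<cdot> (e \<cdot> p \<cdot> e)" using v(1) by simp
  finally have vpe: "v \<cdot> (p \<cdot> e) = e" by (simp only: v)
  have "p \<cdot> v \<cdot> x = p \<cdot> (v \<cdot> (p \<cdot> e)) \<cdot> q" using v(1) by (simp add: x_eq)
  also have "\<dots> = x" by (simp only: vpe x_eq)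
  finally show thesis using v(1,2) by (intro that[of "p \<cdot> v"]) simp_all
qed

text \<open>Each principal right ideal is minimal: \<open>x y\<close> generates the same one as \<open>x\<close>. Writing
  \<open>x = f x\<close> with \<open>f e = f\<close>, the inverse of \<open>e x y e\<close> brings \<open>x y e\<close> back to \<open>f\<close>.\<close>

lemma right_mult_reversible:
  assumes x: "x \<in> S" and y: "y \<in> S"
  obtains w where "w \<in> S" "x \<cdot> y \<cdot> w = x"
proof -
  obtain e where e: "primitive_idempotent S (\<cdot>) e" using ex_primitive by blast
  note [simp] = primitive_idempotentD(1,2)[OF e] x y closed assoc
  obtain f where f [simp]: "f \<in> S" "f \<cdot> e = f" "f \<cdot> x = x"
    by (rule left_unit_below[OF e x])
  have f' [simp]: "f \<cdot> (e \<cdot> z) = f \<cdot> z" "f \<cdot> (x \<cdot> z) = x \<cdot> z" if "z \<in> S" for z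
    using that by (simp_all flip: assoc)
  obtain v where v: "v \<in> S" "e \<cdot> (x \<cdot> y) \<cdot> e \<cdot> v = e"
    by (rule inverse_in_local_monoid[OF e closed[OF x y]])
  have "x \<cdot> y \<cdot> (e \<cdot> v \<cdot> x) = f \<cdot> (e \<cdot> (x \<cdot> y) \<cdot> e \<cdot> v) \<cdot> x"
    using v(1) by simp
  also have "\<dots> = x" by (simp only: v f)
  finally show thesis using v(1) by (intro that[of "e \<cdot> v \<cdot> x"]) simp_all
qed

end

text \<open>Passing to the opposite semigroup turns statements about the first variable of a term into
  statements about the last one.\<close>

lemma completely_simple_semigroup_opposite:
  assumes "completely_simple_semigroup S mul"
  shows "completely_simple_semigroup S (\<lambda>x y. mul y x)"
proof -
  interpret completely_simple_semigroup S mul by (fact assms)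
  show ?thesis
  proof
    show "I = S" if "semigroup_ideal S (\<lambda>x y. mul y x) I" for I
      using that by (intro simple) (auto simp: semigroup_ideal_def)
    show "\<exists>e. primitive_idempotent S (\<lambda>x y. mul y x) e"
      using ex_primitive by (auto simp: primitive_idempotent_def conj_ac)
  qed (simp_all add: closed assoc)
qed

section \<open>Terms and left units of their first factors\<close>

primrec rename_vars :: "(nat \<Rightarrow> nat) \<Rightarrow> binary_term \<Rightarrow> binary_term" where
  "rename_vars f (Var i) = Var (f i)"
| "rename_vars f (Mul s t) = Mul (rename_vars f s) (rename_vars f t)"

primrec mirror :: "binary_term \<Rightarrow> binary_term" where
  "mirror (Var i) = Var i"
| "mirror (Mul s t) = Mul (mirror t) (mirror s)"

primrec first_var :: "binary_term \<Rightarrow> nat" where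
  "first_var (Var i) = i"
| "first_var (Mul s t) = first_var s"

lemma vars_rename_vars: "vars (rename_vars f t) = f ` vars t"
  by (induction t) auto

lemma eval_term_rename_vars:
  assumes "\<And>i. i \<in> vars t \<Longrightarrow> xs ! f i = ys ! i"
  shows "eval_term mul (rename_vars f t) xs = eval_term mul t ys"
  using assms by (induction t) auto

lemma vars_mirror: "vars (mirror t) = vars t"
  by (induction t) auto

lemma eval_term_mirror: "eval_term (\<lambda>x y. mul y x) (mirror t) xs = eval_term mul t xs"
  by (induction t) auto

lemma first_var_in_vars: "first_var t \<in> vars t"
  by (induction t) auto

lemma congruence_on_opposite:
  "congruence_on S mul r \<Longrightarrow> congruence_on S (\<lambda>x y. mul y x) r"
  by (auto simp: congruence_on_def)

lemma congruence_onD: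
  assumes "congruence_on S mul r"
  shows "equiv S r" and "r \<subseteq> S \<times> S" and "x \<in> S \<Longrightarrow> (x, x) \<in> r"
    and "(x, y) \<in> r \<Longrightarrow> (y, x) \<in> r"
    and "(x, y) \<in> r \<Longrightarrow> (y, z) \<in> r \<Longrightarrow> (x, z) \<in> r"
    and "(x, y) \<in> r \<Longrightarrow> (u, v) \<in> r \<Longrightarrow> (mul x u, mul y v) \<in> r"
proof -
  show eq: "equiv S r" using assms by (simp add: congruence_on_def)
  then show "r \<subseteq> S \<times> S" "x \<in> S \<Longrightarrow> (x, x) \<in> r"
    "(x, y) \<in> r \<Longrightarrow> (y, x) \<in> r" "(x, y) \<in> r \<Longrightarrow> (y, z) \<in> r \<Longrightarrow> (x, z) \<in> r"
    by (auto simp: equiv_def refl_on_def dest: symD transD)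
  show "(x, y) \<in> r \<Longrightarrow> (u, v) \<in> r \<Longrightarrow> (mul x u, mul y v) \<in> r"
    using assms by (auto simp: congruence_on_def)
qed

context completely_simple_semigroup
begin

text \<open>A product whose first factor is fixed from the left by \<open>f\<close> is itself fixed by \<open>f\<close>. Stating this
  modulo \<open>\<delta>\<close> allows left units to be transported along \<open>\<delta>\<close>.\<close>

lemma left_unit_of_first_var:
  assumes \<delta>: "congruence_on S (\<cdot>) \<delta>"
    and "f \<in> S" "set xs \<subseteq> S" "vars t \<subseteq> {..<length xs}"
    and "(f \<cdot> xs ! first_var t, xs ! first_var t) \<in> \<delta>"
  shows "(f \<cdot> eval_term (\<cdot>) t xs, eval_term (\<cdot>) t xs) \<in> \<delta>"
  using assms(4,5)
proof (induction t)
  case (Mul s t)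
  have S: "eval_term (\<cdot>) s xs \<in> S" "eval_term (\<cdot>) t xs \<in> S"
    using Mul.prems assms(3) by (auto intro: eval_term_closed)
  then have "(f \<cdot> eval_term (\<cdot>) s xs \<cdot> eval_term (\<cdot>) t xs,
      eval_term (\<cdot>) s xs \<cdot> eval_term (\<cdot>) t xs) \<in> \<delta>"
    using Mul congruence_onD(3,6)[OF \<delta>] by simp
  then show ?case using S assms(2) by (simp add: assoc)
qed simp

text \<open>Right multiplication is reversible, so the factors after the first one can be removed
  successively.\<close>

lemma first_var_recoverable:
  assumes "set xs \<subseteq> S" "vars t \<subseteq> {..<length xs}"
  obtains w where "w \<in> S" "eval_term (\<cdot>) t xs \<cdot> w = xs ! first_var t"
proof -
  have "\<exists>w\<in>S. eval_term (\<cdot>) t xs \<cdot> w = xs ! first_var t"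
    using assms(2)
  proof (induction t)
    case (Var i)
    then have x: "xs ! i \<in> S" using assms(1) by auto
    obtain w where "w \<in> S" "xs ! i \<cdot> xs ! i \<cdot> w = xs ! i"
      by (rule right_mult_reversible[OF x x])
    then show ?case using x by (auto simp: assoc intro: closed)
  next
    case (Mul s t)
    have S: "eval_term (\<cdot>) s xs \<in> S" "eval_term (\<cdot>) t xs \<in> S"
      using Mul.prems assms(1) by (auto intro: eval_term_closed)
    obtain w where w: "w \<in> S" "eval_term (\<cdot>) s xs \<cdot> w = xs ! first_var s"
      using Mul by auto
    obtain w' where w': "w' \<in> S" "eval_term (\<cdot>) s xs \<cdot> eval_term (\<cdot>) t xs \<cdot> w' = eval_term (\<cdot>) s xs"
      by (rule right_mult_reversible[OF S])
    have "eval_term (\<cdot>) s xs \<cdot> eval_term (\<cdot>) t xs \<cdot> (w' \<cdot> w)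
        = eval_term (\<cdot>) s xs \<cdot> eval_term (\<cdot>) t xs \<cdot> w' \<cdot> w"
      using S w(1) w'(1) by (simp add: assoc closed)
    then show ?case using w w' by (auto intro: closed)
  qed
  then show thesis using that by blast
qed

text \<open>The left unit \<open>f\<close> of the first factor of \<open>t(b,c)\<close> also works for \<open>t(b,d)\<close> modulo \<open>\<delta>\<close>. This
  is clear if the first factor is \<open>b\<close>. Otherwise the first factors are some \<open>c\<^sub>i\<close> and \<open>d\<^sub>i\<close>. Then
  \<open>f\<close> fixes \<open>t(a,c)\<close>, hence it fixes \<open>t(a,d)\<close> modulo \<open>\<delta>\<close>, and hence it fixes \<open>d\<^sub>i\<close>, which is a right
  multiple of \<open>t(a,d)\<close>.\<close>

lemma common_left_unit:
  assumes e: "primitive_idempotent S (\<cdot>) e" and \<delta>: "congruence_on S (\<cdot>) \<delta>"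
    and t: "vars t \<subseteq> {..n}"
    and S: "a \<in> S" "b \<in> S" "set c \<subseteq> S" "set d \<subseteq> S" and len: "length c = n" "length d = n"
    and A: "(eval_term (\<cdot>) t (a # c), eval_term (\<cdot>) t (a # d)) \<in> \<delta>"
  obtains f where "f \<in> S" "f \<cdot> e = f"
    "(f \<cdot> eval_term (\<cdot>) t (b # c), eval_term (\<cdot>) t (b # c)) \<in> \<delta>"
    "(f \<cdot> eval_term (\<cdot>) t (b # d), eval_term (\<cdot>) t (b # d)) \<in> \<delta>"
proof -
  note \<delta>D = congruence_onD[OF \<delta>]
  have vars: "vars t \<subseteq> {..<length (x # c)}" "vars t \<subseteq> {..<length (x # d)}" for x
    using t len by auto
  have sets: "set (x # c) \<subseteq> S" "set (x # d) \<subseteq> S" if "x \<in> S" for x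
    using that S by auto
  note closed_eval = eval_term_closed[OF sets(1) vars(1)] eval_term_closed[OF sets(2) vars(2)]
  let ?i = "first_var t"
  have i: "?i < Suc n" using first_var_in_vars[of t] t by auto
  then have "(b # c) ! ?i \<in> S"
    using sets(1)[OF S(2)] len by (metis length_Cons nth_mem subsetD)
  then obtain f where f: "f \<in> S" "f \<cdot> e = f" "f \<cdot> (b # c) ! ?i = (b # c) ! ?i"
    by (rule left_unit_below[OF e])
  let ?A = "eval_term (\<cdot>) t (a # c)" and ?A' = "eval_term (\<cdot>) t (a # d)"
  have "(f \<cdot> (b # c) ! ?i, (b # c) ! ?i) \<in> \<delta>"
    using f(3) \<open>(b # c) ! ?i \<in> S\<close> \<delta>D(3) by simp
  moreover have "(f \<cdot> (b # d) ! ?i, (b # d) ! ?i) \<in> \<delta>"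
  proof (cases "?i = 0")
    case True
    then show ?thesis using f(3) S(2) \<delta>D(3) by simp
  next
    case False
    then have same: "(a # c) ! ?i = (b # c) ! ?i" "(a # d) ! ?i = (b # d) ! ?i"
      by (cases ?i; simp)+
    have "(f \<cdot> ?A, ?A) \<in> \<delta>"
      using calculation same
      by (intro left_unit_of_first_var[OF \<delta> f(1) sets(1)[OF S(1)] vars(1)]) simp
    moreover have "(f \<cdot> ?A, f \<cdot> ?A') \<in> \<delta>" using \<delta>D(3)[OF f(1)] A by (rule \<delta>D(6))
    ultimately have fA': "(f \<cdot> ?A', ?A') \<in> \<delta>" using A \<delta>D(4,5) by metis
    obtain w where w: "w \<in> S" "?A' \<cdot> w = (a # d) ! ?i"
      by (rule first_var_recoverable[OF sets(2)[OF S(1)] vars(2)])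
    have "(f \<cdot> ?A' \<cdot> w, ?A' \<cdot> w) \<in> \<delta>" using fA' \<delta>D(3)[OF w(1)] by (rule \<delta>D(6))
    then show ?thesis
      using f(1) w same(2) closed_eval(2)[OF S(1)] by (simp add: assoc)
  qed
  ultimately show thesis
    using f(1,2) S by (intro that[of f] left_unit_of_first_var[OF \<delta> _ _ vars(1)]
      left_unit_of_first_var[OF \<delta> _ _ vars(2)] sets) auto
qed

end

section \<open>Quotients\<close>

context semigroup_on
begin

abbreviation pullback :: "('a \<times> 'a) set \<Rightarrow> ('a set \<times> 'a set) set \<Rightarrow> ('a \<times> 'a) set" where
  "pullback \<eta> \<Delta> \<equiv> {(x, y). x \<in> S \<and> y \<in> S \<and> (\<eta> `` {x}, \<eta> `` {y}) \<in> \<Delta>}"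

lemma eval_term_quotient:
  assumes "congruence_on S mul \<eta>" "set xs \<subseteq> S" "vars t \<subseteq> {..<length xs}"
  shows "eval_term (quotient_mul mul \<eta>) t (map (\<lambda>x. \<eta> `` {x}) xs) = \<eta> `` {eval_term mul t xs}"
  using assms(2,3)
  by (induction t) (auto simp: quotient_mul_class[OF assms(1)] eval_term_closed)

lemma quotient_congruence_pullback:
  assumes "congruence_on (S // \<eta>) (quotient_mul mul \<eta>) \<Delta>"
  shows "quotient_congruence (pullback \<eta> \<Delta>) \<eta> = \<Delta>"
  using congruence_onD(2)[OF assms] by (auto simp: quotient_congruence_def quotient_def) blast

lemma pullback_quotient_congruence:
  assumes "congruence_on S mul \<eta>" "congruence_on S mul \<theta>" "\<eta> \<subseteq> \<theta>"
  shows "pullback \<eta> (quotient_congruence \<theta> \<eta>) = \<theta>"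
  using quotient_congruence_iff[OF assms] congruence_onD(2)[OF assms(2)] by auto

lemma congruence_on_pullback:
  assumes \<eta>: "congruence_on S mul \<eta>"
    and \<Delta>: "congruence_on (S // \<eta>) (quotient_mul mul \<eta>) \<Delta>"
  shows "congruence_on S mul (pullback \<eta> \<Delta>)" and "\<eta> \<subseteq> pullback \<eta> \<Delta>"
proof -
  note D = congruence_onD[OF \<Delta>]
  have "equiv S (pullback \<eta> \<Delta>)"
    by (rule equivI) (auto simp: refl_on_def quotientI intro!: D(3) symI transI intro: D(4,5))
  moreover have "(mul x u, mul y v) \<in> pullback \<eta> \<Delta>"
    if "(x, y) \<in> pullback \<eta> \<Delta>" "(u, v) \<in> pullback \<eta> \<Delta>" for x y u v
    using that D(6)[of "\<eta> `` {x}" "\<eta> `` {y}" "\<eta> `` {u}" "\<eta> `` {v}"]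
    by (auto simp: quotient_mul_class[OF \<eta>] closed)
  ultimately show "congruence_on S mul (pullback \<eta> \<Delta>)" unfolding congruence_on_def by blast
  show "\<eta> \<subseteq> pullback \<eta> \<Delta>"
  proof (intro subrelI)
    fix x y assume xy: "(x, y) \<in> \<eta>"
    then have "x \<in> S" "y \<in> S" using congruence_onD(2)[OF \<eta>] by auto
    moreover have "\<eta> `` {x} = \<eta> `` {y}"
      using xy congruence_onD(1)[OF \<eta>] by (rule equiv_class_eq[rotated])
    ultimately show "(x, y) \<in> pullback \<eta> \<Delta>" using D(3) by (auto simp: quotientI)
  qed
qed

lemma congruence_on_quotient_congruence:
  assumes \<eta>: "congruence_on S mul \<eta>" and \<theta>: "congruence_on S mul \<theta>" and "\<eta> \<subseteq> \<theta>"
  shows "congruence_on (S // \<eta>) (quotient_mul mul \<eta>) (quotient_congruence \<theta> \<eta>)"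
proof -
  note iff = quotient_congruence_iff[OF assms] and D = congruence_onD[OF \<theta>]
  have sub: "quotient_congruence \<theta> \<eta> \<subseteq> S // \<eta> \<times> S // \<eta>"
    using D(2) by (auto simp: quotient_congruence_def intro!: quotientI)
  have "equiv (S // \<eta>) (quotient_congruence \<theta> \<eta>)"
  proof (rule equivI)
    show "refl_on (S // \<eta>) (quotient_congruence \<theta> \<eta>)"
      by (rule refl_onI) (auto elim!: quotientE simp: iff D(3))
    show "sym (quotient_congruence \<theta> \<eta>)"
      by (rule symI) (auto simp: quotient_congruence_def dest: D(4))
    show "trans (quotient_congruence \<theta> \<eta>)"
    proof (rule transI)
      fix X Y Z
      assume *: "(X, Y) \<in> quotient_congruence \<theta> \<eta>" "(Y, Z) \<in> quotient_congruence \<theta> \<eta>"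
      then obtain x y z where "x \<in> S" "y \<in> S" "z \<in> S"
        "X = \<eta> `` {x}" "Y = \<eta> `` {y}" "Z = \<eta> `` {z}"
        using sub by (blast elim!: quotientE)
      then show "(X, Z) \<in> quotient_congruence \<theta> \<eta>" using * D(5) by (auto simp: iff)
    qed
  qed (fact sub)
  moreover have "(quotient_mul mul \<eta> X U, quotient_mul mul \<eta> Y V) \<in> quotient_congruence \<theta> \<eta>"
    if "(X, Y) \<in> quotient_congruence \<theta> \<eta>" "(U, V) \<in> quotient_congruence \<theta> \<eta>" for X Y U V
  proof -
    obtain x y u v where xy: "(x, y) \<in> \<theta>" "X = \<eta> `` {x}" "Y = \<eta> `` {y}"
      and uv: "(u, v) \<in> \<theta>" "U = \<eta> `` {u}" "V = \<eta> `` {v}"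
      using \<open>(X, Y) \<in> _\<close> \<open>(U, V) \<in> _\<close> unfolding quotient_congruence_def by blast
    then have "x \<in> S" "y \<in> S" "u \<in> S" "v \<in> S" using D(2) by auto
    then show ?thesis
      using D(6)[OF xy(1) uv(1)] xy uv by (simp add: quotient_mul_class[OF \<eta>] iff closed)
  qed
  ultimately show ?thesis unfolding congruence_on_def by blast
qed

text \<open>The two conditions are the same once the elements of \<open>S/\<eta>\<close> are written as classes, because
  evaluating a term at classes gives the class of its value.\<close>

lemma centralizes_quotient_iff:
  assumes \<eta>: "congruence_on S mul \<eta>" and \<rho>: "congruence_on S mul \<rho>" "\<eta> \<subseteq> \<rho>"
    and \<sigma>: "congruence_on S mul \<sigma>" "\<eta> \<subseteq> \<sigma>"
  shows "centralizes (S // \<eta>) (quotient_mul mul \<eta>)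
      (quotient_congruence \<rho> \<eta>) (quotient_congruence \<sigma> \<eta>) \<Delta>
    \<longleftrightarrow> centralizes S mul \<rho> \<sigma> (pullback \<eta> \<Delta>)" (is "?Q \<longleftrightarrow> ?P")
proof -
  let ?cls = "\<lambda>x. \<eta> `` {x}"
  have eval: "eval_term (quotient_mul mul \<eta>) t (?cls x # map ?cls xs)
      = ?cls (eval_term mul t (x # xs))" and eval_closed: "eval_term mul t (x # xs) \<in> S"
    if "x \<in> S" "xs \<in> lists S" "vars t \<subseteq> {..<Suc (length xs)}" for x xs t
    using that eval_term_quotient[OF \<eta>, of "x # xs" t] eval_term_closed[of "x # xs" t]
    by (auto simp: in_lists_conv_set subset_iff)
  have rel: "(?cls (c ! i), ?cls (d ! i)) \<in> quotient_congruence \<sigma> \<eta> \<longleftrightarrow> (c ! i, d ! i) \<in> \<sigma>"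
    if "c \<in> lists S" "d \<in> lists S" "i < length c" "i < length d" for c d i
    using that by (intro quotient_congruence_iff[OF \<eta> \<sigma>]) (auto simp: in_lists_conv_set)
  have "S // \<eta> = ?cls ` S" by (auto simp: quotient_def)
  then have ball: "(\<forall>X\<in>S // \<eta>. Q X) \<longleftrightarrow> (\<forall>x\<in>S. Q (?cls x))"
    and ball_lists: "(\<forall>X\<in>lists (S // \<eta>). R X) \<longleftrightarrow> (\<forall>x\<in>lists S. R (map ?cls x))" for Q R
    by (simp_all add: lists_image)
  have ball_terms: "(\<forall>t\<in>term_functions m k. T t) \<longleftrightarrow>
      (\<forall>t. vars t \<subseteq> {..<k} \<longrightarrow> T (eval_term m t))" for m :: "'b \<Rightarrow> 'b \<Rightarrow> 'b" and k T
    by (auto simp: term_functions_def)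
  show ?thesis
    unfolding centralizes_def ball ball_lists ball_terms
    by (intro all_cong imp_cong ball_cong refl)
      (simp_all add: eval eval_closed rel quotient_congruence_iff[OF \<eta> \<rho>])
qed

end

section \<open>Centralization is inherited by larger congruences\<close>

text \<open>The term of the polynomial \<open>F(x,z,z') = e t(x,z) e u e t(p,z') e\<close>, with the constants \<open>p, e, u\<close>
  as its last three arguments. Both blocks \<open>z\<close> and \<open>z'\<close> are arguments, because \<open>F\<close> will be used with
  \<open>c\<close> and \<open>d\<close> in both orders: \<open>c\<^sub>i \<sigma> d\<^sub>i\<close> allows \<open>(c,d)\<close> to be exchanged for \<open>(d,c)\<close>.\<close>

lemma paired_term:
  assumes t: "vars t \<subseteq> {..<n + 1}"
  obtains F where "vars F \<subseteq> {..<(2 * n + 3) + 1}"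
    "\<And>x z z' p e u. length z = n \<Longrightarrow> length z' = n \<Longrightarrow>
      eval_term mul F (x # z @ z' @ [p, e, u])
      = mul e (mul (eval_term mul t (x # z)) (mul e (mul u (mul e (mul (eval_term mul t (p # z')) e)))))"
proof -
  \<comment> \<open>The first variable of the second copy of \<open>t\<close> becomes the constant \<open>p\<close>, which follows \<open>x\<close>
    and the two blocks; the others move from the block \<open>z\<close> to the block \<open>z'\<close>.\<close>
  define swap where "swap i = (if i = 0 then 2 * n + 1 else n + i)" for i :: nat
  define E where "E = Var (2 * n + 2)"
  define U where "U = Var (2 * n + 3)"
  define F where "F = Mul E (Mul t (Mul E (Mul U (Mul E (Mul (rename_vars swap t) E)))))"
  have t_less: "i \<le> n" if "i \<in> vars t" for i using that t by fastforce
  show thesis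
  proof (rule that[of F])
    have "i < 4 + 2 * n" if "i \<in> vars t" for i using t_less[OF that] by simp
    moreover have "swap i < 4 + 2 * n" if "i \<in> vars t" for i
      using t_less[OF that] by (simp add: swap_def)
    ultimately show "vars F \<subseteq> {..<(2 * n + 3) + 1}"
      unfolding F_def E_def U_def by (auto simp: vars_rename_vars)
  next
    fix x p e u :: 'a and z z' :: "'a list"
    assume len: "length z = n" "length z' = n"
    let ?args = "x # z @ z' @ [p, e, u]"
    have "?args ! i = (x # z) ! i" if "i \<in> vars t" for i
      using t_less[OF that] len by (cases i) (simp_all add: nth_append)
    then have "eval_term mul (rename_vars id t) ?args = eval_term mul t (x # z)"
      by (intro eval_term_rename_vars) simp
    moreover have "rename_vars id s = s" for s by (induction s) auto
    ultimately have t1: "eval_term mul t ?args = eval_term mul t (x # z)" by simp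
    have "?args ! swap i = (p # z') ! i" if "i \<in> vars t" for i
      using t_less[OF that] len by (cases i) (simp_all add: swap_def nth_append)
    then have t2: "eval_term mul (rename_vars swap t) ?args = eval_term mul t (p # z')"
      by (rule eval_term_rename_vars)
    have "?args ! (2 * n + 2) = e" "?args ! (2 * n + 3) = u"
      using len by (simp_all add: nth_Cons' nth_append)
    then show "eval_term mul F ?args = mul e (mul (eval_term mul t (x # z))
        (mul e (mul u (mul e (mul (eval_term mul t (p # z')) e)))))"
      by (simp add: F_def E_def U_def t1 t2 del: nth_Cons_Suc)
  qed
qed

context completely_simple_semigroup
begin

text \<open>The elements \<open>f\<close> and \<open>g\<close> absorb \<open>e\<close>, so \<open>f (e x e) g = f x g\<close>, and they act on \<open>x\<close>
  and \<open>y\<close> as units modulo \<open>\<delta>\<close>.\<close>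

lemma rel_if_local_rel:
  assumes \<delta>: "congruence_on S (\<cdot>) \<delta>" and S: "e \<in> S" "f \<in> S" "g \<in> S" "x \<in> S" "y \<in> S"
    and fg: "f \<cdot> e = f" "e \<cdot> g = g"
    and x: "(f \<cdot> x, x) \<in> \<delta>" "(x \<cdot> g, x) \<in> \<delta>" and y: "(f \<cdot> y, y) \<in> \<delta>" "(y \<cdot> g, y) \<in> \<delta>"
    and xy: "(e \<cdot> x \<cdot> e, e \<cdot> y \<cdot> e) \<in> \<delta>"
  shows "(x, y) \<in> \<delta>"
proof -
  note D = congruence_onD[OF \<delta>]
  have sandwich: "f \<cdot> (e \<cdot> z \<cdot> e) \<cdot> g = f \<cdot> z \<cdot> g" if "z \<in> S" for z
  proof -
    have "f \<cdot> (e \<cdot> z \<cdot> e) \<cdot> g = (f \<cdot> e) \<cdot> z \<cdot> (e \<cdot> g)" using that S by (simp add: assoc closed)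
    then show ?thesis by (simp only: fg)
  qed
  have "(f \<cdot> (e \<cdot> x \<cdot> e) \<cdot> g, f \<cdot> (e \<cdot> y \<cdot> e) \<cdot> g) \<in> \<delta>"
    by (rule D(6)[OF D(6)[OF D(3)[OF S(2)] xy] D(3)[OF S(3)]])
  then have "(f \<cdot> x \<cdot> g, f \<cdot> y \<cdot> g) \<in> \<delta>" using S by (simp add: sandwich)
  moreover have "(f \<cdot> z \<cdot> g, z) \<in> \<delta>" if "(f \<cdot> z, z) \<in> \<delta>" "(z \<cdot> g, z) \<in> \<delta>" for z
    using D(5)[OF D(6)[OF that(1) D(3)[OF S(3)]] that(2)] .
  ultimately show ?thesis using x y D(4,5) by meson
qed

text \<open>The assumption \<open>C(\<rho>,\<sigma>;\<delta>\<^sub>0)\<close> says nothing about \<open>t\<close> directly, as \<open>t(a,c)\<close> and \<open>t(a,d)\<close> are related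
  only by \<open>\<delta>\<close>. It is therefore applied to a term whose two values at \<open>a\<close> are equal, in which \<open>t(a,z')\<close>
  compensates for the change of \<open>t(a,z)\<close>.\<close>

lemma centralizes_local:
  assumes e: "primitive_idempotent S (\<cdot>) e"
    and \<sigma>: "congruence_on S (\<cdot>) \<sigma>"
    and \<delta>\<^sub>0: "congruence_on S (\<cdot>) \<delta>\<^sub>0" and \<delta>: "congruence_on S (\<cdot>) \<delta>"
    and cent: "centralizes S (\<cdot>) \<rho> \<sigma> \<delta>\<^sub>0" and sub: "\<delta>\<^sub>0 \<subseteq> \<delta>"
    and t: "vars t \<subseteq> {..<n + 1}"
    and S: "a \<in> S" "b \<in> S" "c \<in> lists S" "d \<in> lists S" and len: "length c = n" "length d = n"
    and ab: "(a, b) \<in> \<rho>" and cd: "\<forall>i<n. (c ! i, d ! i) \<in> \<sigma>"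
    and A: "(eval_term (\<cdot>) t (a # c), eval_term (\<cdot>) t (a # d)) \<in> \<delta>"
  shows "(e \<cdot> eval_term (\<cdot>) t (b # c) \<cdot> e, e \<cdot> eval_term (\<cdot>) t (b # d) \<cdot> e) \<in> \<delta>"
proof -
  note eD = primitive_idempotentD(1,2)[OF e]
  have ev: "eval_term (\<cdot>) t (x # xs) \<in> S" if "x \<in> S" "xs \<in> lists S" "length xs = n" for x xs
    using that t by (intro eval_term_closed) auto
  let ?A = "eval_term (\<cdot>) t (a # c)" and ?A' = "eval_term (\<cdot>) t (a # d)"
  let ?B = "eval_term (\<cdot>) t (b # c)" and ?B' = "eval_term (\<cdot>) t (b # d)"
  have in_S: "?A \<in> S" "?A' \<in> S" "?B \<in> S" "?B' \<in> S" using ev S len by auto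
  obtain u where u: "u \<in> S" "e \<cdot> ?A \<cdot> e \<cdot> u = e" "u \<cdot> (e \<cdot> ?A \<cdot> e) = e"
    by (rule inverse_in_local_monoid[OF e in_S(1)])
  obtain F where F_vars: "vars F \<subseteq> {..<(2 * n + 3) + 1}"
    and F: "\<And>x z z'. length z = n \<Longrightarrow> length z' = n \<Longrightarrow>
      eval_term (\<cdot>) F (x # z @ z' @ [a, e, u])
      = e \<cdot> (eval_term (\<cdot>) t (x # z) \<cdot> (e \<cdot> (u \<cdot> (e \<cdot> (eval_term (\<cdot>) t (a # z') \<cdot> e)))))"
    by (rule paired_term[OF t, where mul = "(\<cdot>)"]) blast
  have F_term: "eval_term (\<cdot>) F \<in> term_functions (\<cdot>) ((2 * n + 3) + 1)"
    using F_vars by (auto simp: term_functions_def)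
  have dc: "\<forall>i<n. (d ! i, c ! i) \<in> \<sigma>" using cd congruence_onD(4)[OF \<sigma>] by blast
  have consts_rel: "([a, e, u] ! i, [a, e, u] ! i) \<in> \<sigma>" if "i < 3" for i
    using that S(1) eD(1) u(1) congruence_onD(3)[OF \<sigma>]
    by (simp add: numeral_3_eq_3 less_Suc_eq) auto
  have args_rel: "((c @ d @ [a, e, u]) ! i, (d @ c @ [a, e, u]) ! i) \<in> \<sigma>" if i: "i < 2 * n + 3" for i
  proof -
    consider "i < n" | "n \<le> i" "i - n < n" | "n \<le> i" "n \<le> i - n" "i - n - n < 3"
      using i by linarith
    then show ?thesis
    proof cases
      case 1
      then show ?thesis using len cd by (simp add: nth_append)
    next
      case 2
      then show ?thesis using len dc by (simp add: nth_append)
    next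
      case 3
      then have "(c @ d @ [a, e, u]) ! i = [a, e, u] ! (i - n - n)"
        "(d @ c @ [a, e, u]) ! i = [a, e, u] ! (i - n - n)"
        using len by (simp_all add: nth_append del: diff_diff_left)
      then show ?thesis using consts_rel[OF 3(3)] by (simp only:)
    qed
  qed
  have step: "(eval_term (\<cdot>) F (b # c @ d @ [a, e, u]), eval_term (\<cdot>) F (b # d @ c @ [a, e, u])) \<in> \<delta>\<^sub>0"
    if "(eval_term (\<cdot>) F (a # c @ d @ [a, e, u]), eval_term (\<cdot>) F (a # d @ c @ [a, e, u])) \<in> \<delta>\<^sub>0"
    by (rule cent[unfolded centralizes_def, rule_format, OF _ F_term S(1,2) _ _ _ _ ab _ that])
      (use args_rel len S eD u(1) in simp_all)
  have cancel_left: "e \<cdot> (?A \<cdot> (e \<cdot> (u \<cdot> (e \<cdot> (?A' \<cdot> e))))) = e \<cdot> ?A' \<cdot> e"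
  proof -
    have "e \<cdot> (?A \<cdot> (e \<cdot> (u \<cdot> (e \<cdot> (?A' \<cdot> e))))) = (e \<cdot> ?A \<cdot> e \<cdot> u) \<cdot> (e \<cdot> ?A' \<cdot> e)"
      using in_S eD(1) u(1) by (simp add: assoc closed)
    also have "\<dots> = (e \<cdot> e) \<cdot> ?A' \<cdot> e"
      unfolding u(2) using in_S eD(1) by (simp only: assoc closed)
    finally show ?thesis by (simp only: eD(2))
  qed
  have cancel_right: "e \<cdot> (z \<cdot> (e \<cdot> (u \<cdot> (e \<cdot> (?A \<cdot> e))))) = e \<cdot> z \<cdot> e" if "z \<in> S" for z
  proof -
    have "e \<cdot> (z \<cdot> (e \<cdot> (u \<cdot> (e \<cdot> (?A \<cdot> e))))) = e \<cdot> z \<cdot> e \<cdot> (u \<cdot> (e \<cdot> ?A \<cdot> e))"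
      using that in_S eD(1) u(1) by (simp add: assoc closed)
    also have "\<dots> = e \<cdot> z \<cdot> (e \<cdot> e)"
      unfolding u(3) using that eD(1) by (simp only: assoc closed)
    finally show ?thesis by (simp only: eD(2))
  qed
  have "eval_term (\<cdot>) F (a # c @ d @ [a, e, u]) = eval_term (\<cdot>) F (a # d @ c @ [a, e, u])"
    by (simp only: F[OF len] F[OF len(2,1)] cancel_left cancel_right[OF in_S(2)])
  moreover have "eval_term (\<cdot>) F (a # d @ c @ [a, e, u]) \<in> S"
    using in_S eD(1) u(1) by (simp add: F[OF len(2,1)] closed)
  ultimately have "(eval_term (\<cdot>) F (b # c @ d @ [a, e, u]), eval_term (\<cdot>) F (b # d @ c @ [a, e, u])) \<in> \<delta>"
    using step congruence_onD(3)[OF \<delta>\<^sub>0] sub by auto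
  then have "(e \<cdot> (?B \<cdot> (e \<cdot> (u \<cdot> (e \<cdot> (?A' \<cdot> e))))), e \<cdot> ?B' \<cdot> e) \<in> \<delta>"
    by (simp only: F[OF len] F[OF len(2,1)] cancel_right[OF in_S(4)])
  moreover have "(e \<cdot> (?B \<cdot> (e \<cdot> (u \<cdot> (e \<cdot> (?A \<cdot> e))))), e \<cdot> (?B \<cdot> (e \<cdot> (u \<cdot> (e \<cdot> (?A' \<cdot> e)))))) \<in> \<delta>"
    using A in_S eD(1) u(1) by (intro congruence_onD(6)[OF \<delta>] congruence_onD(3)[OF \<delta>])
  then have "(e \<cdot> ?B \<cdot> e, e \<cdot> (?B \<cdot> (e \<cdot> (u \<cdot> (e \<cdot> (?A' \<cdot> e)))))) \<in> \<delta>"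
    by (simp only: cancel_right[OF in_S(3)])
  ultimately show ?thesis by (rule congruence_onD(5)[OF \<delta>, rotated])
qed

text \<open>It remains to pass from \<open>e t(b,c) e\<close> and \<open>e t(b,d) e\<close> to \<open>t(b,c)\<close> and \<open>t(b,d)\<close>. The right unit
  \<open>g\<close> comes from applying \<open>common_left_unit\<close> to the mirrored term in the opposite semigroup.\<close>

lemma centralizes_mono:
  assumes \<sigma>: "congruence_on S (\<cdot>) \<sigma>"
    and \<delta>\<^sub>0: "congruence_on S (\<cdot>) \<delta>\<^sub>0" and cent: "centralizes S (\<cdot>) \<rho> \<sigma> \<delta>\<^sub>0"
    and \<delta>: "congruence_on S (\<cdot>) \<delta>" and sub: "\<delta>\<^sub>0 \<subseteq> \<delta>"
  shows "centralizes S (\<cdot>) \<rho> \<sigma> \<delta>"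
  unfolding centralizes_def
proof (intro allI ballI impI)
  fix n t a b c d
  assume "t \<in> term_functions (\<cdot>) (n + 1)"
    and S: "a \<in> S" "b \<in> S" "c \<in> lists S" "d \<in> lists S" and len: "length c = n" "length d = n"
    and ab: "(a, b) \<in> \<rho>" and cd: "\<forall>i<n. (c ! i, d ! i) \<in> \<sigma>"
    and "(t (a # c), t (a # d)) \<in> \<delta>"
  then obtain s where s: "vars s \<subseteq> {..<n + 1}" and t: "t = eval_term (\<cdot>) s"
    and A: "(eval_term (\<cdot>) s (a # c), eval_term (\<cdot>) s (a # d)) \<in> \<delta>"
    by (auto simp: term_functions_def)
  obtain e where e: "primitive_idempotent S (\<cdot>) e" using ex_primitive by blast
  have sets: "set c \<subseteq> S" "set d \<subseteq> S" using S by auto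
  have s_atMost: "vars s \<subseteq> {..n}" using s by auto
  obtain f where f: "f \<in> S" "f \<cdot> e = f"
    "(f \<cdot> eval_term (\<cdot>) s (b # c), eval_term (\<cdot>) s (b # c)) \<in> \<delta>"
    "(f \<cdot> eval_term (\<cdot>) s (b # d), eval_term (\<cdot>) s (b # d)) \<in> \<delta>"
    by (rule common_left_unit[OF e \<delta> s_atMost S(1,2) sets len A])
  interpret op: completely_simple_semigroup S "\<lambda>x y. y \<cdot> x"
    by (rule completely_simple_semigroup_opposite) unfold_locales
  have e_op: "primitive_idempotent S (\<lambda>x y. y \<cdot> x) e"
    using e by (auto simp: primitive_idempotent_def)
  obtain g where g: "g \<in> S" "e \<cdot> g = g"
    "(eval_term (\<cdot>) s (b # c) \<cdot> g, eval_term (\<cdot>) s (b # c)) \<in> \<delta>"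
    "(eval_term (\<cdot>) s (b # d) \<cdot> g, eval_term (\<cdot>) s (b # d)) \<in> \<delta>"
    by (rule op.common_left_unit[OF e_op congruence_on_opposite[OF \<delta>],
      of "mirror s" n a b c d, unfolded vars_mirror eval_term_mirror,
      OF s_atMost S(1,2) sets len A])
  have B: "eval_term (\<cdot>) s (b # c) \<in> S" "eval_term (\<cdot>) s (b # d) \<in> S"
    using s S sets len by (auto intro!: eval_term_closed)
  have "(e \<cdot> eval_term (\<cdot>) s (b # c) \<cdot> e, e \<cdot> eval_term (\<cdot>) s (b # d) \<cdot> e) \<in> \<delta>"
    by (rule centralizes_local[OF e \<sigma> \<delta>\<^sub>0 \<delta> cent sub s S len ab cd A])
  then show "(t (b # c), t (b # d)) \<in> \<delta>"
    unfolding t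
    by (rule rel_if_local_rel[OF \<delta> primitive_idempotentD(1)[OF e] f(1) g(1) B f(2) g(2)
      f(3) g(3) f(4) g(4)])
qed

end

section \<open>Commutators in quotients\<close>

theorem proposition5p3:
  fixes S :: "'a set" and mul :: "'a \<Rightarrow> 'a \<Rightarrow> 'a" and \<rho> \<sigma> \<eta> :: "('a \<times> 'a) set"
  assumes "completely_simple_semigroup S mul"
    and "congruence_on S mul \<rho>" and "congruence_on S mul \<sigma>" and "congruence_on S mul \<eta>"
    and "\<eta> \<subseteq> \<rho>" and "\<eta> \<subseteq> \<sigma>"
  shows "commutator (S // \<eta>) (quotient_mul mul \<eta>)
           (quotient_congruence \<rho> \<eta>) (quotient_congruence \<sigma> \<eta>)
         = quotient_congruence (congruence_join S mul (commutator S mul \<rho> \<sigma>) \<eta>) \<eta>"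
proof -
  interpret completely_simple_semigroup S mul by (fact assms(1))
  interpret Q: semigroup_on "S // \<eta>" "quotient_mul mul \<eta>"
    by (rule semigroup_on_quotient[OF assms(4)])
  let ?join = "congruence_join S mul (commutator S mul \<rho> \<sigma>) \<eta>"
  let ?\<rho> = "quotient_congruence \<rho> \<eta>" and ?\<sigma> = "quotient_congruence \<sigma> \<eta>"
  let ?\<Delta> = "commutator (S // \<eta>) (quotient_mul mul \<eta>) ?\<rho> ?\<sigma>"
  note iff = centralizes_quotient_iff[OF assms(4,2,5,3,6)]
  note comm = commutator_least[where \<alpha> = \<rho> and \<beta> = \<sigma>]
    and \<Delta> = Q.commutator_least[where \<alpha> = ?\<rho> and \<beta> = ?\<sigma>]
  note join = congruence_join_least[OF comm(1) assms(4)]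
  have "centralizes S mul \<rho> \<sigma> ?join"
    by (rule centralizes_mono[OF assms(3) comm(1,2) join(1,2)])
  then have "centralizes (S // \<eta>) (quotient_mul mul \<eta>) ?\<rho> ?\<sigma> (quotient_congruence ?join \<eta>)"
    by (simp only: iff pullback_quotient_congruence[OF assms(4) join(1,3)])
  then have le: "?\<Delta> \<subseteq> quotient_congruence ?join \<eta>"
    by (rule \<Delta>(3)[OF congruence_on_quotient_congruence[OF assms(4) join(1,3)]])
  note pull = congruence_on_pullback[OF assms(4) \<Delta>(1)]
  have "centralizes S mul \<rho> \<sigma> (pullback \<eta> ?\<Delta>)" using \<Delta>(2) by (simp only: iff)
  then have "?join \<subseteq> pullback \<eta> ?\<Delta>" by (intro join(4) comm(3) pull(1,2))
  then have "quotient_congruence ?join \<eta> \<subseteq> quotient_congruence (pullback \<eta> ?\<Delta>) \<eta>"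
    unfolding quotient_congruence_def by blast
  then show ?thesis using le by (simp only: quotient_congruence_pullback[OF \<Delta>(1)])
qed

end
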